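(* Let $a<b$ be real numbers, let $w,f:[a,b]\to\mathbb{R}$ be differentiable, and let $\psi:[0,1]\to[0,1]$ be a function. For $\lambda\in[0,1]$ and $s,t\in[a,b]$ put $$K(s,t)=\begin{cases} w(s)-\left(w(a)+\psi(\lambda)\frac{w(b)-w(a)}{2}\right), & s\in[a,t),\\ w(s)-\left(w(a)+(1+\psi(1-\lambda))\frac{w(b)-w(a)}{2}\right), & s\in[t,b].\end{cases}$$ Then for all $x\in[a,b]$ and all $\lambda\in[0,1]$, $$\begin{aligned} &\Bigg|\left[\frac{1+\psi(1-\lambda)-\psi(\lambda)}{2(b-a)}f(x)+\frac{\psi(\lambda)f(a)+(1-\psi(1-\lambda))f(b)}{2(b-a)}\right]\int_a^bw'(t)dt\\ &\quad-\frac{1}{b-a}\int_a^bw'(t)f(t)dt-\frac{f(b)-f(a)}{(b-a)^2}\int_a^bK(t,x)dt\Bigg|\\ &\le\left[\frac{1}{b-a}\int_a^bK^2(t,x)dt-\left(\frac{1}{b-a}\int_a^bK(t,x)dt\right)^2\right]^{1/2}\\ &\quad\times\left[\frac{1}{b-a}\int_a^b\left(f'(t)\right)^2dt-\left(\frac{1}{b-a}\int_a^bf'(t)dt\right)^2\right]^{1/2}. \end{aligned}$$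
   Context: Here $[a,b]$ is the usual real interval. All integrals displayed in the claim are understood to exist (as Lebesgue integrals). *)

theory Defs
  imports "HOL-Analysis.Analysis"
begin

text \<open>Two-branch Peano-type kernel; only its values for \<open>s, t \<in> {a..b}\<close> are relevant, where
  \<open>s < t\<close> means \<open>s \<in> {a..<t}\<close>.\<close>

definition peano_kernel ::
    "real \<Rightarrow> real \<Rightarrow> (real \<Rightarrow> real) \<Rightarrow> (real \<Rightarrow> real) \<Rightarrow> real \<Rightarrow> real \<Rightarrow> real \<Rightarrow> real" where
  "peano_kernel a b w \<psi> \<mu> s t =
     (if s < t then w s - (w a + \<psi> \<mu> * ((w b - w a) / 2))
      else w s - (w a + (1 + \<psi> (1 - \<mu>)) * ((w b - w a) / 2)))"

end

theory Submission
  imports Defs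
begin

text \<open>Integration by parts on each side of the jump of the kernel at \<open>x\<close> turns the bracketed
  expression on the left-hand side into \<open>1 / (b - a)\<close> times the integral of \<open>K(t, x) f'(t)\<close>. The
  quantity to be estimated is therefore the covariance of \<open>K(-, x)\<close> and \<open>f'\<close> with respect to the
  uniform distribution on \<open>[a, b]\<close>, and Cauchy--Schwarz bounds it by the product of the two
  standard deviations.\<close>

text \<open>Domination: \<open>\<bar>p * q\<bar> \<le> p\<^sup>2 + q\<^sup>2\<close> pointwise. This
  supplies the integrability of \<open>K t x * f' t\<close>, which is not among the hypotheses of
  the theorem.\<close>

lemma integrable_mult_of_squares:
  fixes u v :: "'a \<Rightarrow> real"
  assumes [measurable]: "u \<in> borel_measurable M" "v \<in> borel_measurable M"
    and "integrable M (\<lambda>t. (u t)\<^sup>2)" "integrable M (\<lambda>t. (v t)\<^sup>2)"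
  shows "integrable M (\<lambda>t. u t * v t)"
proof (rule Bochner_Integration.integrable_bound)
  show "integrable M (\<lambda>t. (u t)\<^sup>2 + (v t)\<^sup>2)"
    using assms by simp
  have "\<bar>p * q\<bar> \<le> p\<^sup>2 + q\<^sup>2" for p q :: real
    using sum_squares_bound[of "\<bar>p\<bar>" "\<bar>q\<bar>"] abs_ge_zero[of "p * q"]
    by (simp only: abs_mult power2_abs)
  then show "AE t in M. norm (u t * v t) \<le> norm ((u t)\<^sup>2 + (v t)\<^sup>2)"
    by simp
qed simp

text \<open>Discriminant argument: the integral of \<open>(u t - r * v t)\<^sup>2\<close> is a
  quadratic polynomial in \<open>r\<close> that is never negative.\<close>

lemma Cauchy_Schwarz_integral:
  fixes u v :: "'a \<Rightarrow> real"
  assumes u: "integrable M (\<lambda>t. (u t)\<^sup>2)" and v: "integrable M (\<lambda>t. (v t)\<^sup>2)"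
    and uv: "integrable M (\<lambda>t. u t * v t)"
  shows "(\<integral>t. u t * v t \<partial>M)\<^sup>2 \<le> (\<integral>t. (u t)\<^sup>2 \<partial>M) * (\<integral>t. (v t)\<^sup>2 \<partial>M)"
proof -
  define A B C where "A = (\<integral>t. (u t)\<^sup>2 \<partial>M)" and "B = (\<integral>t. (v t)\<^sup>2 \<partial>M)"
    and "C = (\<integral>t. u t * v t \<partial>M)"
  have quad: "0 \<le> A - 2 * r * C + r\<^sup>2 * B" for r
  proof -
    have "0 \<le> (\<integral>t. (u t - r * v t)\<^sup>2 \<partial>M)"
      by simp
    also have "\<dots> = (\<integral>t. (u t)\<^sup>2 - 2 * r * (u t * v t) + r\<^sup>2 * (v t)\<^sup>2 \<partial>M)"
      by (intro Bochner_Integration.integral_cong) (auto simp: power2_eq_square algebra_simps)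
    also have "\<dots> = A - 2 * r * C + r\<^sup>2 * B"
      using u v uv by (simp add: A_def B_def C_def)
    finally show ?thesis .
  qed
  have "0 \<le> B"
    by (simp add: B_def)
  have "C\<^sup>2 \<le> A * B"
  proof (cases "B = 0")
    case True
    have "C = 0"
    proof (rule ccontr)
      assume "C \<noteq> 0"
      \<comment> \<open>With \<open>B = 0\<close> the polynomial is affine in \<open>r\<close>; this
        \<open>r\<close> solves \<open>A - 2 * r * C = -1\<close>.\<close>
      with quad[of "(A + 1) / (2 * C)"] True show False
        by (simp add: field_simps)
    qed
    with True show ?thesis by simp
  next
    case False
    then have "B > 0" using \<open>0 \<le> B\<close> by simp
    \<comment> \<open>\<open>C / B\<close> is the minimiser, where the polynomial equals
      \<open>A - C\<^sup>2 / B\<close>.\<close>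
    with quad[of "C / B"] show ?thesis
      by (simp add: field_simps power2_eq_square)
  qed
  then show ?thesis
    by (simp add: A_def B_def C_def)
qed

text \<open>Cauchy--Schwarz for the centred functions \<open>u - p\<close> and \<open>v - q\<close>,
  where \<open>p\<close> and \<open>q\<close> are the means. The factor \<open>1 / m\<close>
  normalises the measure to a probability.\<close>

lemma covariance_le:
  fixes u v :: "'a \<Rightarrow> real"
  assumes "finite_measure M" and m: "measure M (space M) = m" "m > 0"
    and u: "integrable M u" "integrable M (\<lambda>t. (u t)\<^sup>2)"
    and v: "integrable M v" "integrable M (\<lambda>t. (v t)\<^sup>2)"
  shows "\<bar>1 / m * (\<integral>t. u t * v t \<partial>M) - (1 / m * (\<integral>t. u t \<partial>M)) * (1 / m * (\<integral>t. v t \<partial>M))\<bar>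
    \<le> sqrt (1 / m * (\<integral>t. (u t)\<^sup>2 \<partial>M) - (1 / m * (\<integral>t. u t \<partial>M))\<^sup>2)
      * sqrt (1 / m * (\<integral>t. (v t)\<^sup>2 \<partial>M) - (1 / m * (\<integral>t. v t \<partial>M))\<^sup>2)"
proof -
  interpret finite_measure M by fact
  define p q where "p = 1 / m * (\<integral>t. u t \<partial>M)" and "q = 1 / m * (\<integral>t. v t \<partial>M)"
  \<comment> \<open>One centring identity yields the covariance and both variances, through the
    pairs \<open>(u, v)\<close>, \<open>(u, u)\<close> and \<open>(v, v)\<close>.\<close>
  have prod: "integrable M (\<lambda>t. (g t - c) * (h t - d))"
      "1 / m * (\<integral>t. (g t - c) * (h t - d) \<partial>M) = 1 / m * (\<integral>t. g t * h t \<partial>M) - c * d"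
    if "integrable M g" "integrable M h" "integrable M (\<lambda>t. g t * h t)"
      and "c = 1 / m * (\<integral>t. g t \<partial>M)" "d = 1 / m * (\<integral>t. h t \<partial>M)"
    for g h :: "'a \<Rightarrow> real" and c d
  proof -
    have eq: "(\<lambda>t. (g t - c) * (h t - d)) = (\<lambda>t. g t * h t - d * g t - c * h t + c * d)"
      by (auto simp: algebra_simps)
    show "integrable M (\<lambda>t. (g t - c) * (h t - d))"
      unfolding eq using that(1-3) by simp
    have "(\<integral>t. (g t - c) * (h t - d) \<partial>M)
        = (\<integral>t. g t * h t \<partial>M) - d * (m * c) - c * (m * d) + c * d * m"
      unfolding eq using that m by simp
    then show "1 / m * (\<integral>t. (g t - c) * (h t - d) \<partial>M) = 1 / m * (\<integral>t. g t * h t \<partial>M) - c * d"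
      using m by (simp add: field_simps)
  qed
  have uv: "integrable M (\<lambda>t. u t * v t)"
    using u v by (intro integrable_mult_of_squares) auto
  note UV = prod[OF u(1) v(1) uv p_def q_def]
  note UU = prod[OF u(1) u(1) u(2)[unfolded power2_eq_square] p_def p_def, folded power2_eq_square]
  note VV = prod[OF v(1) v(1) v(2)[unfolded power2_eq_square] q_def q_def, folded power2_eq_square]
  have "(1 / m * (\<integral>t. (u t - p) * (v t - q) \<partial>M))\<^sup>2
      \<le> (1 / m * (\<integral>t. (u t - p)\<^sup>2 \<partial>M)) * (1 / m * (\<integral>t. (v t - q)\<^sup>2 \<partial>M))"
    \<comment> \<open>On the right, each of the two integrals absorbs one factor
      \<open>1 / m\<close>.\<close>
    using mult_left_mono[OF Cauchy_Schwarz_integral[OF UU(1) VV(1) UV(1)], of "(1 / m)\<^sup>2"]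
    by (simp add: power2_eq_square ac_simps)
  then have "\<bar>1 / m * (\<integral>t. u t * v t \<partial>M) - p * q\<bar>
      \<le> sqrt ((1 / m * (\<integral>t. (u t)\<^sup>2 \<partial>M) - p\<^sup>2) * (1 / m * (\<integral>t. (v t)\<^sup>2 \<partial>M) - q\<^sup>2))"
    unfolding UU(2) VV(2) UV(2) real_sqrt_abs[symmetric]
    by (rule real_sqrt_le_mono)
  then show ?thesis
    by (simp only: p_def q_def real_sqrt_mult)
qed

text \<open>The integrand is the derivative of \<open>(w t - c) * f t\<close>. For the gauge
  integral this suffices: neither summand has to be integrable alone. The constant \<open>c\<close>
  is free because the kernel subtracts different constants on the two sides of its jump.\<close>

lemma has_integral_by_parts_shift:
  fixes w w' f f' :: "real \<Rightarrow> real"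
  assumes "l \<le> r"
    and "\<And>t. t \<in> {l..r} \<Longrightarrow> (w has_real_derivative w' t) (at t within {l..r})"
    and "\<And>t. t \<in> {l..r} \<Longrightarrow> (f has_real_derivative f' t) (at t within {l..r})"
  shows "((\<lambda>t. w' t * f t + (w t - c) * f' t) has_integral
    ((w r - c) * f r - (w l - c) * f l)) {l..r}"
  using assms
  by (intro fundamental_theorem_of_calculus)
    (auto simp flip: has_real_derivative_iff_has_vector_derivative
      intro!: derivative_eq_intros)

text \<open>Integration by parts on both sides of \<open>x\<close> leaves boundary terms. With
  \<open>h = (w b - w a) / 2\<close>, the constants \<open>c\<close> and \<open>d\<close> of the two
  branches satisfy \<open>d - c = (1 + \<psi> (1 - \<mu>) - \<psi> \<mu>) * h\<close>,
  \<open>w a - c = - \<psi> \<mu> * h\<close> and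
  \<open>w b - d = (1 - \<psi> (1 - \<mu>)) * h\<close>, which are the weights of
  \<open>f x\<close>, \<open>f a\<close> and \<open>f b\<close> up to sign.\<close>

lemma has_integral_peano_kernel:
  fixes w w' f f' \<psi> :: "real \<Rightarrow> real"
  assumes x: "x \<in> {a..b}"
    and w: "\<And>t. t \<in> {a..b} \<Longrightarrow> (w has_real_derivative w' t) (at t within {a..b})"
    and f: "\<And>t. t \<in> {a..b} \<Longrightarrow> (f has_real_derivative f' t) (at t within {a..b})"
  shows "((\<lambda>t. w' t * f t + peano_kernel a b w \<psi> \<mu> t x * f' t) has_integral
    ((1 + \<psi> (1 - \<mu>) - \<psi> \<mu>) * f x + (\<psi> \<mu> * f a + (1 - \<psi> (1 - \<mu>)) * f b))
      * ((w b - w a) / 2)) {a..b}"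
proof -
  define c d where "c = w a + \<psi> \<mu> * ((w b - w a) / 2)"
    and "d = w a + (1 + \<psi> (1 - \<mu>)) * ((w b - w a) / 2)"
  let ?g = "\<lambda>t. w' t * f t + peano_kernel a b w \<psi> \<mu> t x * f' t"
  have "(?g has_integral ((w x - c) * f x - (w a - c) * f a)) {a..x}"
  \<comment> \<open>At \<open>t = x\<close> the kernel already takes its second branch, so the first
    formula may fail at this single point. On \<open>{x..b}\<close> the second formula holds
    everywhere.\<close>
  proof (rule has_integral_spike_finite[where S = "{x}"])
    show "((\<lambda>t. w' t * f t + (w t - c) * f' t) has_integral
        ((w x - c) * f x - (w a - c) * f a)) {a..x}"
      using x by (intro has_integral_by_parts_shift)
        (auto intro!: DERIV_subset[OF w] DERIV_subset[OF f])
  qed (auto simp: peano_kernel_def c_def)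
  moreover have "(?g has_integral ((w b - d) * f b - (w x - d) * f x)) {x..b}"
  proof (rule has_integral_eq)
    show "((\<lambda>t. w' t * f t + (w t - d) * f' t) has_integral
        ((w b - d) * f b - (w x - d) * f x)) {x..b}"
      using x by (intro has_integral_by_parts_shift)
        (auto intro!: DERIV_subset[OF w] DERIV_subset[OF f])
  qed (auto simp: peano_kernel_def d_def)
  ultimately have "(?g has_integral ((w x - c) * f x - (w a - c) * f a)
      + ((w b - d) * f b - (w x - d) * f x)) {a..b}"
    using x by (intro has_integral_combine) auto
  also have "((w x - c) * f x - (w a - c) * f a) + ((w b - d) * f b - (w x - d) * f x)
      = ((1 + \<psi> (1 - \<mu>) - \<psi> \<mu>) * f x + (\<psi> \<mu> * f a + (1 - \<psi> (1 - \<mu>)) * f b))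
        * ((w b - w a) / 2)"
    by (simp add: c_def d_def field_simps)
  finally show ?thesis .
qed

theorem corollary27:
  fixes a b x \<mu> :: real and w w' f f' \<psi> :: "real \<Rightarrow> real"
  defines "K \<equiv> peano_kernel a b w \<psi> \<mu>"
  assumes "a < b"
    and "\<And>t. t \<in> {a..b} \<Longrightarrow> (w has_real_derivative w' t) (at t within {a..b})"
    and "\<And>t. t \<in> {a..b} \<Longrightarrow> (f has_real_derivative f' t) (at t within {a..b})"
    and "\<psi> \<in> {0..1} \<rightarrow> {0..1}"
    and "x \<in> {a..b}"
    and "\<mu> \<in> {0..1}"
    and "set_integrable lebesgue {a..b} w'"
    and "set_integrable lebesgue {a..b} (\<lambda>t. w' t * f t)"
    and "set_integrable lebesgue {a..b} (\<lambda>t. K t x)"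
    and "set_integrable lebesgue {a..b} (\<lambda>t. (K t x)\<^sup>2)"
    and "set_integrable lebesgue {a..b} f'"
    and "set_integrable lebesgue {a..b} (\<lambda>t. (f' t)\<^sup>2)"
  shows
    "\<bar>((1 + \<psi> (1 - \<mu>) - \<psi> \<mu>) / (2 * (b - a)) * f x
        + (\<psi> \<mu> * f a + (1 - \<psi> (1 - \<mu>)) * f b) / (2 * (b - a)))
        * (LINT t:{a..b}|lebesgue. w' t)
      - 1 / (b - a) * (LINT t:{a..b}|lebesgue. w' t * f t)
      - (f b - f a) / (b - a)\<^sup>2 * (LINT t:{a..b}|lebesgue. K t x)\<bar>
     \<le> sqrt (1 / (b - a) * (LINT t:{a..b}|lebesgue. (K t x)\<^sup>2)
            - (1 / (b - a) * (LINT t:{a..b}|lebesgue. K t x))\<^sup>2)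
       * sqrt (1 / (b - a) * (LINT t:{a..b}|lebesgue. (f' t)\<^sup>2)
            - (1 / (b - a) * (LINT t:{a..b}|lebesgue. f' t))\<^sup>2)"
proof -
  note ab = assms(2) and w = assms(3) and f = assms(4) and x = assms(6)
  \<comment> \<open>On this finite measure of mass \<open>b - a\<close>, set integrals are plain
    integrals, as \<open>covariance_le\<close> requires.\<close>
  define M where "M = restrict_space lebesgue {a..b}"
  define L where "L = b - a"
  have L: "L > 0"
    using ab by (simp add: L_def)
  have int_iff: "set_integrable lebesgue {a..b} g \<longleftrightarrow> integrable M g"
    and int_eq: "(LINT t:{a..b}|lebesgue. g t) = (\<integral>t. g t \<partial>M)" for g :: "real \<Rightarrow> real"
    by (simp_all add: M_def set_integrable_def set_lebesgue_integral_def
        integrable_restrict_space integral_restrict_space)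
  have M: "finite_measure M" "measure M (space M) = L"
    using ab by (auto simp: M_def L_def space_restrict_space measure_restrict_space
        emeasure_restrict_space intro!: finite_measureI)
  note intK = assms(10,11)[unfolded int_iff] and intf' = assms(12,13)[unfolded int_iff]
  have "integrable M (\<lambda>t. K t x * f' t)"
    using intK intf' by (intro integrable_mult_of_squares) auto
  then have intKf': "set_integrable lebesgue {a..b} (\<lambda>t. K t x * f' t)"
    by (simp only: int_iff)
  \<comment> \<open>The derivative need not be continuous: its gauge integral is always
    \<open>g b - g a\<close>, and a Lebesgue integral, where it exists, agrees with the gauge
    integral.\<close>
  have FTC: "(LINT t:{a..b}|lebesgue. g' t) = g b - g a"
    if "set_integrable lebesgue {a..b} g'"
      and "\<And>t. t \<in> {a..b} \<Longrightarrow> (g has_real_derivative g' t) (at t within {a..b})"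
    for g g' :: "real \<Rightarrow> real"
    using has_integral_unique[OF has_integral_set_lebesgue[OF that(1)]
        fundamental_theorem_of_calculus[of a b g g']] ab that(2)
    by (simp add: has_real_derivative_iff_has_vector_derivative)
  have "(LINT t:{a..b}|lebesgue. w' t * f t) + (LINT t:{a..b}|lebesgue. K t x * f' t)
      = ((1 + \<psi> (1 - \<mu>) - \<psi> \<mu>) * f x + (\<psi> \<mu> * f a + (1 - \<psi> (1 - \<mu>)) * f b))
        * ((w b - w a) / 2)"
    \<comment> \<open>Both summands are Lebesgue integrable here, so the gauge integral of the sum
      splits.\<close>
    using has_integral_unique[OF has_integral_add[OF has_integral_set_lebesgue[OF assms(9)]
          has_integral_set_lebesgue[OF intKf']]
        has_integral_peano_kernel[OF x w f, of \<psi> \<mu>, folded K_def]] .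
  moreover have "(LINT t:{a..b}|lebesgue. w' t) = w b - w a"
    using assms(8) w by (rule FTC)
  ultimately have "(LINT t:{a..b}|lebesgue. w' t * f t) + (LINT t:{a..b}|lebesgue. K t x * f' t)
      = ((1 + \<psi> (1 - \<mu>) - \<psi> \<mu>) * f x + (\<psi> \<mu> * f a + (1 - \<psi> (1 - \<mu>)) * f b))
        * ((LINT t:{a..b}|lebesgue. w' t) / 2)"
    by simp
  moreover have "(p / (2 * L) * y + s / (2 * L)) * h - 1 / L * P = 1 / L * Q"
    if "P + Q = (p * y + s) * (h / 2)" for p y s h P Q :: real
  proof -
    have "(p / (2 * L) * y + s / (2 * L)) * h = 1 / L * ((p * y + s) * (h / 2))"
      using L by (simp add: field_simps)
    then show ?thesis
      by (simp only: that[symmetric] distrib_left add_diff_cancel_left')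
  qed
  ultimately have lhs: "((1 + \<psi> (1 - \<mu>) - \<psi> \<mu>) / (2 * L) * f x
        + (\<psi> \<mu> * f a + (1 - \<psi> (1 - \<mu>)) * f b) / (2 * L)) * (LINT t:{a..b}|lebesgue. w' t)
      - 1 / L * (LINT t:{a..b}|lebesgue. w' t * f t)
      = 1 / L * (LINT t:{a..b}|lebesgue. K t x * f' t)"
    by blast
  \<comment> \<open>Since \<open>f b - f a\<close> is the integral of \<open>f'\<close>, the last
    term on the left is the product of the two means, which completes the covariance.\<close>
  have mean: "(f b - f a) / L\<^sup>2 * (LINT t:{a..b}|lebesgue. K t x)
      = (1 / L * (LINT t:{a..b}|lebesgue. K t x)) * (1 / L * (LINT t:{a..b}|lebesgue. f' t))"
    by (subst FTC[OF assms(12) f]) (auto simp: power2_eq_square)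
  show ?thesis
    unfolding L_def[symmetric] lhs mean unfolding int_eq
    by (rule covariance_le[OF M L intK intf'])
qed

end
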